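(* Let $n, m$ be integers with $0 \le m \le n$, let $D$ be a digraph with vertex set $[n]$, and let $s = (s_1,\dots,s_m) \in [n]^m$. Let $C = \{C_1,\dots,C_m\}$ be the set of cars (drivers), indexed such that $C_i$ prefers spot $s_i$. Then $s$ is a parking function on $D$ if and only if for all $A \subseteq C$ we have \[ |A| \le \Big| \bigcup_{i \,:\, C_i \in A} R_D(s_i) \Big|. \]
   Context: $[n]=\{1,\dots,n\}$. Parking process: given $0\le m\le n$, a sequence $s\in[n]^m$ and a digraph $D$ with vertex set $[n]$ (loops allowed), drivers $1,\dots,m$ attempt to park one by one, in this order. Driver $i$ begins at vertex $s_i$. If the current vertex is unoccupied, the driver parks there; if it is occupied, the driver chooses an out-neighbor of the current vertex and drives there, and repeats this until she parks (and then the next driver enters) or is unable to find an available spot (and then the process terminates). Thus each driver follows a directed walk of her choice starting at $s_i$ and parks at the first unoccupied vertex on it. The sequence $s$ is a parking function on $D$ if it is possible (for some choices of the drivers) for all $m$ drivers to park. For $i,j\in[n]$ write $i \preceq_D j$ if there is a directed path from $i$ to $j$ in $D$, with the convention $i\preceq_D i$. The set of vertices reachable from $i$ is $R_D(i)=\{j\in[n] : i\preceq_D j\}$. *)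

theory Defs
  imports "Graph_Theory.Graph_Theory" "HOL-Library.FuncSet"
begin

text \<open>Digraphs are given by \<^type>\<open>pair_pre_digraph\<close>: arcs are ordered pairs of vertices, loops are
  allowed and there are no parallel arcs (which would be irrelevant to parking).\<close>

definition reach_set :: "'a pair_pre_digraph \<Rightarrow> 'a \<Rightarrow> 'a set" where
  "reach_set D i = {j \<in> pverts D. i \<rightarrow>\<^sup>*\<^bsub>with_proj D\<^esub> j}"

text \<open>\<open>drive D Occ v w\<close>: a driver who is currently at \<open>v\<close>, when the set of occupied vertices is
  \<open>Occ\<close>, can make choices such that she parks at \<open>w\<close>.\<close>

inductive drive :: "'a pair_pre_digraph \<Rightarrow> 'a set \<Rightarrow> 'a \<Rightarrow> 'a \<Rightarrow> bool"
  for D :: "'a pair_pre_digraph" and Occ :: "'a set" where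
  park: "v \<in> pverts D \<Longrightarrow> v \<notin> Occ \<Longrightarrow> drive D Occ v v"
| move: "v \<in> Occ \<Longrightarrow> (v, u) \<in> parcs D \<Longrightarrow> drive D Occ u w \<Longrightarrow> drive D Occ v w"

text \<open>\<open>parking D s k Occ\<close>: for some choices of the drivers, each of the drivers \<open>1, \<dots>, k\<close>, entering
  in this order, manages to park, and the set of occupied vertices is then \<open>Occ\<close>. Driver \<open>i\<close>
  begins at \<open>s i\<close>.\<close>

inductive parking :: "'a pair_pre_digraph \<Rightarrow> (nat \<Rightarrow> 'a) \<Rightarrow> nat \<Rightarrow> 'a set \<Rightarrow> bool"
  for D :: "'a pair_pre_digraph" and s :: "nat \<Rightarrow> 'a" where
  start: "parking D s 0 {}"
| enter: "parking D s k Occ \<Longrightarrow> drive D Occ (s (Suc k)) w \<Longrightarrow> parking D s (Suc k) (insert w Occ)"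

definition parking_function :: "'a pair_pre_digraph \<Rightarrow> nat \<Rightarrow> (nat \<Rightarrow> 'a) \<Rightarrow> bool" where
  "parking_function D m s \<longleftrightarrow> (\<exists>Occ. parking D s m Occ)"

end

theory Submission
  imports Defs
begin

text \<open>
  A driver who starts at \<open>v\<close> is stuck only if every vertex reachable from \<open>v\<close> is occupied, so the
  question is which free spot each driver should take. That the counting condition is necessary is
  plain: the drivers in \<open>A\<close> occupy distinct spots, each reachable from some \<open>s i\<close> with \<open>i \<in> A\<close>.

  For sufficiency, the drivers are served in order while Hall's condition is maintained for those
  still waiting, with respect to the spots still free: every set \<open>A\<close> of waiting drivers reaches at
  least \<open>card A\<close> free spots. Occupying a spot \<open>w\<close> can only harm a \<^emph>\<open>tight\<close> set, one that reaches
  exactly as many free spots as it has members, and only if it reaches \<open>w\<close>. By submodularity tight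
  sets are closed under union, so there is a largest one, \<open>T\<close>. Hall's condition for \<open>T\<close> together
  with the entering driver \<open>i\<close> gives a free spot \<open>x\<close> that \<open>i\<close> reaches and \<open>T\<close> does not. Driver \<open>i\<close>
  may be unable to get to \<open>x\<close>, as she has to park at the first free spot \<open>w\<close> on her way. But \<open>x\<close> is
  reachable from \<open>w\<close>, so \<open>w\<close> is not reached by \<open>T\<close> either, and parking there is harmless. This is the
  greedy step \<open>hall_step\<close>; it gives the parking directly, without first choosing a spot for every
  driver and then repairing that assignment.
\<close>

definition reach_union :: "'a pair_pre_digraph \<Rightarrow> ('i \<Rightarrow> 'a) \<Rightarrow> 'i set \<Rightarrow> 'a set" where
  "reach_union D s A = (\<Union>i\<in>A. reach_set D (s i))"

definition hall_outside :: "'a pair_pre_digraph \<Rightarrow> ('i \<Rightarrow> 'a) \<Rightarrow> 'a set \<Rightarrow> 'i set \<Rightarrow> bool" where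
  "hall_outside D s Occ I \<longleftrightarrow> (\<forall>A\<subseteq>I. card A \<le> card (reach_union D s A - Occ))"

lemma reach_union_subset: "reach_union D s A \<subseteq> pverts D"
  by (auto simp: reach_union_def reach_set_def)

lemma reach_union_Un: "reach_union D s (A \<union> B) = reach_union D s A \<union> reach_union D s B"
  by (auto simp: reach_union_def)

lemma reach_union_mono: "A \<subseteq> B \<Longrightarrow> reach_union D s A \<subseteq> reach_union D s B"
  by (auto simp: reach_union_def)

lemma (in pair_wf_digraph) reach_set_trans:
  assumes "w \<in> reach_set G v" "x \<in> reach_set G w"
  shows "x \<in> reach_set G v"
  using assms reachable_trans[of v w x] by (simp add: reach_set_def)

lemma (in pair_wf_digraph) reach_union_closed:
  assumes "w \<in> reach_union G s A" "x \<in> reach_set G w"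
  shows "x \<in> reach_union G s A"
  using assms reach_set_trans by (fastforce simp: reach_union_def)

lemma drive_free: "drive D Occ v w \<Longrightarrow> w \<notin> Occ"
  by (induction rule: drive.induct) auto

lemma (in pair_wf_digraph) drive_reach_set: "drive G Occ v w \<Longrightarrow> w \<in> reach_set G v"
proof (induction rule: drive.induct)
  case (park v)
  then show ?case by (simp add: reach_set_def)
next
  case (move v u w)
  then show ?case
    by (auto simp: reach_set_def intro: adj_reachable_trans)
qed

text \<open>She parks at the first free vertex of a path to \<open>x\<close>; the rest of the path leads to \<open>x\<close>.\<close>

lemma (in pair_wf_digraph) drive_towards:
  assumes "x \<in> reach_set G v" "x \<notin> Occ"
  obtains w where "drive G Occ v w" "x \<in> reach_set G w"
proof -
  from assms(1) have "v \<rightarrow>\<^sup>*\<^bsub>with_proj G\<^esub> x" by (simp add: reach_set_def)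
  then have "\<exists>w. drive G Occ v w \<and> x \<in> reach_set G w"
  proof (induction rule: converse_reachable_induct)
    case base
    with assms show ?case by (auto simp: reach_set_def intro: drive.park)
  next
    case (step v u)
    show ?case
    proof (cases "v \<in> Occ")
      case True
      with step show ?thesis by (auto intro: drive.move)
    next
      case False
      have vx: "v \<rightarrow>\<^sup>*\<^bsub>with_proj G\<^esub> x"
        using step.hyps by (rule adj_reachable_trans)
      then have "v \<in> pverts G" "x \<in> pverts G"
        using reachable_in_verts by fastforce+
      with vx False show ?thesis by (auto simp: reach_set_def intro: drive.park)
    qed
  qed
  with that show thesis by blast
qed

text \<open>The number of free spots reached is a submodular function of the set of drivers. Since Hall's
  condition bounds it below by cardinality, which is modular, the sets attaining the bound form a
  lattice.\<close>

lemma tight_Un: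
  assumes fin: "finite (pverts D)" "finite I"
    and hall: "hall_outside D s Occ I"
    and AB: "A \<subseteq> I" "B \<subseteq> I"
    and tight: "card (reach_union D s A - Occ) = card A" "card (reach_union D s B - Occ) = card B"
  shows "card (reach_union D s (A \<union> B) - Occ) = card (A \<union> B)"
proof -
  let ?F = "\<lambda>A. reach_union D s A - Occ"
  have finF: "finite (?F X)" for X
    by (rule finite_Diff[OF finite_subset[OF reach_union_subset fin(1)]])
  have "?F (A \<inter> B) \<subseteq> ?F A \<inter> ?F B"
    by (auto simp: reach_union_def)
  then have "card (?F (A \<inter> B)) \<le> card (?F A \<inter> ?F B)"
    using finF by (simp add: card_mono)
  moreover have "card (A \<inter> B) \<le> card (?F (A \<inter> B))" "card (A \<union> B) \<le> card (?F (A \<union> B))"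
    using hall AB by (simp_all add: hall_outside_def le_infI1)
  moreover have "card (?F A) + card (?F B) = card (?F (A \<union> B)) + card (?F A \<inter> ?F B)"
    using card_Un_Int[OF finF finF, of A B] by (simp add: reach_union_Un Un_Diff)
  moreover have "card A + card B = card (A \<union> B) + card (A \<inter> B)"
    using AB fin(2) by (intro card_Un_Int) (auto intro: finite_subset)
  ultimately show ?thesis using tight by linarith
qed

lemma largest_tight_set:
  assumes fin: "finite (pverts D)" "finite I" and hall: "hall_outside D s Occ I"
  obtains T where "T \<subseteq> I" "card (reach_union D s T - Occ) = card T"
    "\<And>A. A \<subseteq> I \<Longrightarrow> card (reach_union D s A - Occ) = card A \<Longrightarrow> A \<subseteq> T"
proof -
  define S where "S = {A. A \<subseteq> I \<and> card (reach_union D s A - Occ) = card A}"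
  have "finite S" using fin(2) by (simp add: S_def)
  moreover have "{} \<in> S" by (simp add: S_def reach_union_def)
  ultimately obtain T where T: "T \<in> S" and max: "\<forall>A\<in>S. T \<subseteq> A \<longrightarrow> T = A"
    using finite_has_maximal[of S] by auto
  have "A \<subseteq> T" if "A \<in> S" for A
  proof -
    have "T \<union> A \<in> S" using tight_Un[OF assms, of T A] T that by (simp add: S_def)
    with max show ?thesis by blast
  qed
  with T show thesis by (intro that[of T]) (simp_all add: S_def)
qed

text \<open>The greedy step: the entering driver \<open>i\<close> can park so that Hall's condition survives for the
  drivers \<open>I\<close> behind her. She heads for a spot outside the reach of the largest tight subset of
  \<open>I\<close>; since that reach is closed under following arcs, she cannot be stopped inside it.\<close>

lemma (in pair_wf_digraph) hall_step:
  assumes fin: "finite (pverts G)" "finite I" and "i \<notin> I"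
    and hall: "hall_outside G s Occ (insert i I)"
  obtains w where "drive G Occ (s i) w" "hall_outside G s (insert w Occ) I"
proof -
  let ?F = "\<lambda>A. reach_union G s A - Occ"
  have finF: "finite (?F X)" for X
    by (rule finite_Diff[OF finite_subset[OF reach_union_subset fin(1)]])
  have hallI: "hall_outside G s Occ I"
    using hall by (auto simp: hall_outside_def)
  obtain T where T: "T \<subseteq> I" "card (?F T) = card T"
    and largest: "\<And>A. A \<subseteq> I \<Longrightarrow> card (?F A) = card A \<Longrightarrow> A \<subseteq> T"
    using largest_tight_set[OF fin hallI] by metis
  have "card (insert i T) \<le> card (?F (insert i T))"
    using hall T(1) unfolding hall_outside_def by (meson insert_mono)
  moreover have "card (insert i T) = Suc (card T)"
    using T(1) fin(2) \<open>i \<notin> I\<close> by (subst card_insert_disjoint) (auto intro: finite_subset)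
  ultimately have "\<not> ?F (insert i T) \<subseteq> ?F T"
    using T(2) card_mono[OF finF[of T], of "?F (insert i T)"] by linarith
  then obtain x where x: "x \<in> reach_set G (s i)" "x \<notin> Occ" "x \<notin> reach_union G s T"
    by (auto simp: reach_union_def)
  from x(1,2) obtain w where w: "drive G Occ (s i) w" "x \<in> reach_set G w"
    by (rule drive_towards)
  have wT: "w \<notin> reach_union G s T"
    using reach_union_closed[OF _ w(2)] x(3) by blast
  have "card A \<le> card (reach_union G s A - insert w Occ)" if A: "A \<subseteq> I" for A
  proof (cases "card (?F A) = card A")
    case True
    have "A \<subseteq> T" using A True by (rule largest)
    then have "w \<notin> reach_union G s A" using wT reach_union_mono[of A T G s] by auto
    then have "reach_union G s A - insert w Occ = ?F A" by blast
    with True show ?thesis by simp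
  next
    case False
    with hallI A have "card A < card (?F A)"
      by (simp add: hall_outside_def le_neq_implies_less)
    moreover have "card (?F A) - 1 \<le> card (?F A - {w})"
      by (simp add: card_Diff_singleton_if)
    moreover have "reach_union G s A - insert w Occ = ?F A - {w}" by blast
    ultimately show ?thesis by simp
  qed
  then have "hall_outside G s (insert w Occ) I" by (simp add: hall_outside_def)
  with w(1) show thesis by (rule that)
qed

lemma (in pair_wf_digraph) parking_if_hall:
  assumes fin: "finite (pverts G)" and hall: "hall_outside G s {} {1..m}" and "k \<le> m"
  shows "\<exists>Occ. parking G s k Occ \<and> hall_outside G s Occ {Suc k..m}"
  using \<open>k \<le> m\<close>
proof (induction k)
  case 0
  with hall show ?case by (auto intro: parking.start)
next
  case (Suc k)
  then obtain Occ where Occ: "parking G s k Occ" "hall_outside G s Occ {Suc k..m}" by auto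
  moreover have "{Suc k..m} = insert (Suc k) {Suc (Suc k)..m}"
    using Suc.prems by auto
  ultimately obtain w where
    "drive G Occ (s (Suc k)) w" "hall_outside G s (insert w Occ) {Suc (Suc k)..m}"
    using hall_step[OF fin, of "{Suc (Suc k)..m}" "Suc k" s Occ] by auto
  with Occ(1) show ?case by (auto intro: parking.enter)
qed

text \<open>Intersecting with \<open>Occ\<close> makes the induction work: the spot of the newest driver is then a new
  element on the right-hand side.\<close>

lemma (in pair_wf_digraph) hall_if_parking:
  assumes "parking G s k Occ"
  shows "finite Occ \<and> (\<forall>A\<subseteq>{1..k}. card A \<le> card (reach_union G s A \<inter> Occ))"
  using assms
proof (induction rule: parking.induct)
  case start
  then show ?case by simp
next
  case (enter k Occ w)
  then have fin: "finite Occ" and IH: "\<And>A. A \<subseteq> {1..k} \<Longrightarrow> card A \<le> card (reach_union G s A \<inter> Occ)"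
    by auto
  have "card A \<le> card (reach_union G s A \<inter> insert w Occ)" if A: "A \<subseteq> {1..Suc k}" for A
  proof -
    let ?B = "A - {Suc k}"
    have "?B \<subseteq> {1..k}" using A by (auto simp: le_Suc_eq)
    note B = IH[OF this]
    have RB: "reach_union G s ?B \<subseteq> reach_union G s A"
      by (rule reach_union_mono) blast
    show ?thesis
    proof (cases "Suc k \<in> A")
      case True
      have w: "w \<in> reach_union G s A" "w \<notin> Occ"
        using True drive_reach_set[OF enter.hyps(2)] drive_free[OF enter.hyps(2)]
        by (auto simp: reach_union_def)
      have "card A = Suc (card ?B)"
        using True A by (metis card.remove finite_atLeastAtMost finite_subset)
      also have "\<dots> \<le> card (insert w (reach_union G s ?B \<inter> Occ))"
        using B w fin by simp
      also have "\<dots> \<le> card (reach_union G s A \<inter> insert w Occ)"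
        using RB w fin by (intro card_mono) auto
      finally show ?thesis .
    next
      case False
      then have "?B = A" by blast
      with B have "card A \<le> card (reach_union G s A \<inter> Occ)" by simp
      also have "\<dots> \<le> card (reach_union G s A \<inter> insert w Occ)"
        using fin by (intro card_mono) auto
      finally show ?thesis .
    qed
  qed
  with fin show ?case by simp
qed

theorem theorem1:
  fixes n m :: nat and D :: "nat pair_pre_digraph" and s :: "nat \<Rightarrow> nat"
  assumes "m \<le> n"
    and "pair_wf_digraph D" and "pverts D = {1..n}"
    and "s \<in> {1..m} \<rightarrow> {1..n}"
  shows "parking_function D m s \<longleftrightarrow>
    (\<forall>A. A \<subseteq> {1..m} \<longrightarrow> card A \<le> card (\<Union>i\<in>A. reach_set D (s i)))"
proof -
  interpret pair_wf_digraph D by fact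
  have fin: "finite (pverts D)" using assms(3) by simp
  have "parking_function D m s \<longleftrightarrow> hall_outside D s {} {1..m}"
  proof
    assume "parking_function D m s"
    then obtain Occ where "parking D s m Occ" by (auto simp: parking_function_def)
    note Occ = hall_if_parking[OF this]
    have "card A \<le> card (reach_union D s A)" if "A \<subseteq> {1..m}" for A
    proof -
      have "card A \<le> card (reach_union D s A \<inter> Occ)" using Occ that by blast
      also have "\<dots> \<le> card (reach_union D s A)"
        using finite_subset[OF reach_union_subset fin] by (intro card_mono) auto
      finally show ?thesis .
    qed
    then show "hall_outside D s {} {1..m}" by (simp add: hall_outside_def)
  next
    assume "hall_outside D s {} {1..m}"
    from parking_if_hall[OF fin this order_refl] show "parking_function D m s"
      by (auto simp: parking_function_def)
  qed
  then show ?thesis by (simp add: hall_outside_def reach_union_def)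
qed

end
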